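(* Let $f:R_{1}\rightarrow R_{2}$ be a surjective ring homomorphism, $J$ an ideal of $R_{2}$, $M_{1}$ an $R_{1}$-module, $M_{2}$ an $R_{2}$-module (regarded as an $R_{1}$-module via $f$), and $\varphi:M_{1}\rightarrow M_{2}$ a surjective $R_{1}$-module homomorphism. Consider the $(R_{1}\Join^{f}J)$-module $M_{1}\Join^{\varphi}JM_{2}$ and let $N_{2}$ be a submodule of $M_{2}$. Then: (1) $\overline{N_{2}}^{\varphi}$ is a weakly prime submodule of $M_{1}\Join^{\varphi}JM_{2}$ if and only if $N_{2}$ is a weakly prime submodule of $M_{2}$ and, for all $r_{1}\in R_{1}$, $m_{1}\in M_{1}$, $m_{2}\in JM_{2}$, $j\in J$ with $(f(r_{1})+j)(\varphi(m_{1})+m_{2})=0$ but $f(r_{1})+j\notin(N_{2}:_{R_{2}}M_{2})$ and $\varphi(m_{1})+m_{2}\notin N_{2}$, we have $r_{1}m_{1}=0$. (2) If $\overline{N_{2}}^{\varphi}$ is a weakly prime submodule of $M_{1}\Join^{\varphi}JM_{2}$, $J\nsubseteq(N_{2}:_{R_{2}}M_{2})$ and $Z_{R_{2}}(N_{2})\cap J=\{0\}$, then $(N_{2}:_{M_{2}}J)$ is a weakly prime submodule of $M_{2}$.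
   Context: Rings are commutative with non-zero identity and modules are unital. For a submodule $N$ of an $R$-module $M$, $(N:_{R}M)=\{r\in R: rM\subseteq N\}$; for an ideal $J$ of $R$, $(N:_{M}J)=\{m\in M: Jm\subseteq N\}$; for an $R$-module $X$, $Z_{R}(X)=\{r\in R: rx=0\text{ for some }x\in X\setminus\{0\}\}$. Amalgamation: $R_{1}\Join^{f}J=\{(r,f(r)+j):r\in R_{1},j\in J\}$, a subring of $R_{1}\times R_{2}$. $M_{1}\Join^{\varphi}JM_{2}=\{(m_{1},\varphi(m_{1})+m_{2}):m_{1}\in M_{1},m_{2}\in JM_{2}\}$ is an $(R_{1}\Join^{f}J)$-module with scalar product $(r,f(r)+j)(m_{1},\varphi(m_{1})+m_{2})=(rm_{1},\varphi(rm_{1})+f(r)m_{2}+j\varphi(m_{1})+jm_{2})$. For a submodule $N_{2}$ of $M_{2}$, $\overline{N_{2}}^{\varphi}=\{(m_{1},\varphi(m_{1})+m_{2})\in M_{1}\Join^{\varphi}JM_{2}:\varphi(m_{1})+m_{2}\in N_{2}\}$. A proper submodule $N$ of an $R$-module $M$ is weakly prime if for all $r\in R$, $m\in M$ with $0\neq rm\in N$, either $r\in(N:_{R}M)$ or $m\in N$. *)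

theory Defs
  imports "HOL-Algebra.Module" "HOL-Algebra.Chinese_Remainder"
begin

section \<open>Residuals, zero divisors and weakly prime submodules\<close>

definition residual_ideal ::
    "('a, 'k) ring_scheme \<Rightarrow> ('a, 'm, 'l) module_scheme \<Rightarrow> 'm set \<Rightarrow> 'a set"
  where "residual_ideal R M N = {r \<in> carrier R. \<forall>m \<in> carrier M. r \<odot>\<^bsub>M\<^esub> m \<in> N}"

definition residual_submodule :: "('a, 'm, 'l) module_scheme \<Rightarrow> 'm set \<Rightarrow> 'a set \<Rightarrow> 'm set"
  where "residual_submodule M N J = {m \<in> carrier M. \<forall>j \<in> J. j \<odot>\<^bsub>M\<^esub> m \<in> N}"

text \<open>The argument is a module, so for a submodule \<open>N\<close> of \<open>M\<close> one writes
  \<open>zero_divisors R (M\<lparr>carrier := N\<rparr>)\<close>.  The zero module has no zero divisors, not even \<open>\<zero>\<close>.\<close>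

definition zero_divisors :: "('a, 'k) ring_scheme \<Rightarrow> ('a, 'm, 'l) module_scheme \<Rightarrow> 'a set"
  where "zero_divisors R M =
    {r \<in> carrier R. \<exists>x \<in> carrier M - {\<zero>\<^bsub>M\<^esub>}. r \<odot>\<^bsub>M\<^esub> x = \<zero>\<^bsub>M\<^esub>}"

definition weakly_prime_submodule ::
    "'m set \<Rightarrow> ('a, 'k) ring_scheme \<Rightarrow> ('a, 'm, 'l) module_scheme \<Rightarrow> bool"
  where "weakly_prime_submodule N R M \<longleftrightarrow>
    submodule N R M \<and> N \<noteq> carrier M \<and>
    (\<forall>r \<in> carrier R. \<forall>m \<in> carrier M.
      r \<odot>\<^bsub>M\<^esub> m \<noteq> \<zero>\<^bsub>M\<^esub> \<and> r \<odot>\<^bsub>M\<^esub> m \<in> N \<longrightarrow> r \<in> residual_ideal R M N \<or> m \<in> N)"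


section \<open>Module homomorphisms, restriction of scalars, and \<open>JM\<close>\<close>

definition module_homs ::
    "('a, 'k) ring_scheme \<Rightarrow> ('a, 'm, 'l) module_scheme \<Rightarrow> ('a, 'n, 'o) module_scheme \<Rightarrow> ('m \<Rightarrow> 'n) set"
  where "module_homs R M N =
    {\<phi> \<in> carrier M \<rightarrow> carrier N.
      (\<forall>x \<in> carrier M. \<forall>y \<in> carrier M. \<phi> (x \<oplus>\<^bsub>M\<^esub> y) = \<phi> x \<oplus>\<^bsub>N\<^esub> \<phi> y) \<and>
      (\<forall>r \<in> carrier R. \<forall>x \<in> carrier M. \<phi> (r \<odot>\<^bsub>M\<^esub> x) = r \<odot>\<^bsub>N\<^esub> \<phi> x)}"

definition restrict_scalars :: "('a \<Rightarrow> 'b) \<Rightarrow> ('b, 'm, 'l) module_scheme \<Rightarrow> ('a, 'm) module"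
  where "restrict_scalars f M =
    \<lparr>carrier = carrier M, mult = mult M, one = one M, zero = zero M, add = add M,
     smult = (\<lambda>r m. f r \<odot>\<^bsub>M\<^esub> m)\<rparr>"

text \<open>The finite sums of products \<open>a m\<close> with \<open>a \<in> J\<close>, \<open>m \<in> M\<close>; compare
  \<^const>\<open>ideal_prod\<close>.  For a (nonempty) ideal \<open>J\<close> the empty sum is \<open>\<zero> m\<close>.\<close>

inductive_set ideal_smult :: "'a set \<Rightarrow> ('a, 'm, 'l) module_scheme \<Rightarrow> 'm set"
  for J and M where
    smult: "a \<in> J \<Longrightarrow> m \<in> carrier M \<Longrightarrow> a \<odot>\<^bsub>M\<^esub> m \<in> ideal_smult J M"
  | sum: "x \<in> ideal_smult J M \<Longrightarrow> y \<in> ideal_smult J M \<Longrightarrow> x \<oplus>\<^bsub>M\<^esub> y \<in> ideal_smult J M"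


section \<open>Amalgamation\<close>

definition amalg_ring ::
    "('a, 'k) ring_scheme \<Rightarrow> ('b, 'l) ring_scheme \<Rightarrow> ('a \<Rightarrow> 'b) \<Rightarrow> 'b set \<Rightarrow> ('a \<times> 'b) ring"
  where "amalg_ring R1 R2 f J =
    (RDirProd R1 R2)\<lparr>carrier := {(r, f r \<oplus>\<^bsub>R2\<^esub> j) | r j. r \<in> carrier R1 \<and> j \<in> J}\<rparr>"

text \<open>A pair \<open>(r, s)\<close> of the amalgamated ring is \<open>(r, f r + j)\<close> with \<open>j = s - f r\<close>, and a pair
  \<open>(m, n)\<close> of the amalgamated module is \<open>(m, \<phi> m + m2)\<close> with \<open>m2 = n - \<phi> m\<close>; the scalar product is
  given in terms of these components (see \<open>amalg_module_smult\<close> and \<open>amalg_module_smult_pair\<close>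
  below).  The fields \<^const>\<open>mult\<close> and \<^const>\<open>one\<close> of a module record carry no meaning.\<close>

definition amalg_module ::
    "('b, 'l) ring_scheme \<Rightarrow> ('a, 'm, 'p) module_scheme \<Rightarrow> ('b, 'n, 'q) module_scheme \<Rightarrow>
     ('a \<Rightarrow> 'b) \<Rightarrow> ('m \<Rightarrow> 'n) \<Rightarrow> 'b set \<Rightarrow> ('a \<times> 'b, 'm \<times> 'n) module"
  where "amalg_module R2 M1 M2 f \<phi> J =
    \<lparr>carrier = {(m1, \<phi> m1 \<oplus>\<^bsub>M2\<^esub> m2) | m1 m2. m1 \<in> carrier M1 \<and> m2 \<in> ideal_smult J M2},
     mult = undefined, one = undefined,
     zero = (\<zero>\<^bsub>M1\<^esub>, \<zero>\<^bsub>M2\<^esub>),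
     add = (\<lambda>(x, y) (x', y'). (x \<oplus>\<^bsub>M1\<^esub> x', y \<oplus>\<^bsub>M2\<^esub> y')),
     smult = (\<lambda>(r, s) (m, n).
       let j = s \<ominus>\<^bsub>R2\<^esub> f r; m2 = n \<ominus>\<^bsub>M2\<^esub> \<phi> m in
         (r \<odot>\<^bsub>M1\<^esub> m,
          \<phi> (r \<odot>\<^bsub>M1\<^esub> m) \<oplus>\<^bsub>M2\<^esub> f r \<odot>\<^bsub>M2\<^esub> m2 \<oplus>\<^bsub>M2\<^esub> j \<odot>\<^bsub>M2\<^esub> \<phi> m \<oplus>\<^bsub>M2\<^esub> j \<odot>\<^bsub>M2\<^esub> m2))\<rparr>"

definition amalg_submodule ::
    "('a, 'm, 'p) module_scheme \<Rightarrow> ('b, 'n, 'q) module_scheme \<Rightarrow> ('m \<Rightarrow> 'n) \<Rightarrow> 'b set \<Rightarrow>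
     'n set \<Rightarrow> ('m \<times> 'n) set"
  where "amalg_submodule M1 M2 \<phi> J N2 =
    {(m1, \<phi> m1 \<oplus>\<^bsub>M2\<^esub> m2) | m1 m2.
      m1 \<in> carrier M1 \<and> m2 \<in> ideal_smult J M2 \<and> \<phi> m1 \<oplus>\<^bsub>M2\<^esub> m2 \<in> N2}"


section \<open>The amalgamation is a ring, respectively a module\<close>

locale amalgamation =
  R1: cring R1 + R2: cring R2 + J: ideal J R2 + M1: module R1 M1 + M2: module R2 M2
  for R1 :: "('a, 'k) ring_scheme" and R2 :: "('b, 'l) ring_scheme" and J
    and M1 :: "('a, 'm, 'p) module_scheme" and M2 :: "('b, 'n, 'q) module_scheme" +
  fixes f :: "'a \<Rightarrow> 'b" and \<phi> :: "'m \<Rightarrow> 'n"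
  assumes f_hom: "f \<in> ring_hom R1 R2"
    and phi_hom: "\<phi> \<in> module_homs R1 M1 (restrict_scalars f M2)"
begin

lemma f_simps [simp]:
  "r \<in> carrier R1 \<Longrightarrow> f r \<in> carrier R2"
  "r \<in> carrier R1 \<Longrightarrow> s \<in> carrier R1 \<Longrightarrow> f (r \<oplus>\<^bsub>R1\<^esub> s) = f r \<oplus>\<^bsub>R2\<^esub> f s"
  "r \<in> carrier R1 \<Longrightarrow> s \<in> carrier R1 \<Longrightarrow> f (r \<otimes>\<^bsub>R1\<^esub> s) = f r \<otimes>\<^bsub>R2\<^esub> f s"
  "f \<one>\<^bsub>R1\<^esub> = \<one>\<^bsub>R2\<^esub>"
  using f_hom by (auto simp: ring_hom_def)

lemma phi_simps [simp]:
  "x \<in> carrier M1 \<Longrightarrow> \<phi> x \<in> carrier M2"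
  "x \<in> carrier M1 \<Longrightarrow> y \<in> carrier M1 \<Longrightarrow> \<phi> (x \<oplus>\<^bsub>M1\<^esub> y) = \<phi> x \<oplus>\<^bsub>M2\<^esub> \<phi> y"
  "r \<in> carrier R1 \<Longrightarrow> x \<in> carrier M1 \<Longrightarrow> \<phi> (r \<odot>\<^bsub>M1\<^esub> x) = f r \<odot>\<^bsub>M2\<^esub> \<phi> x"
  using phi_hom by (auto simp: module_homs_def restrict_scalars_def)

lemma f_zero [simp]: "f \<zero>\<^bsub>R1\<^esub> = \<zero>\<^bsub>R2\<^esub>"
  using ring_hom_zero[OF f_hom R1.ring_axioms R2.ring_axioms] .

lemma phi_zero [simp]: "\<phi> \<zero>\<^bsub>M1\<^esub> = \<zero>\<^bsub>M2\<^esub>"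
  using phi_simps(3)[OF R1.zero_closed M1.zero_closed] by simp

lemma ideal_smult_closed: "x \<in> ideal_smult J M2 \<Longrightarrow> x \<in> carrier M2"
  by (induction rule: ideal_smult.induct) auto

lemma smult_ideal_smult:
  "x \<in> ideal_smult J M2 \<Longrightarrow> r \<in> carrier R2 \<Longrightarrow> r \<odot>\<^bsub>M2\<^esub> x \<in> ideal_smult J M2"
proof (induction rule: ideal_smult.induct)
  case (smult a m)
  then have "(r \<otimes>\<^bsub>R2\<^esub> a) \<odot>\<^bsub>M2\<^esub> m \<in> ideal_smult J M2"
    by (intro ideal_smult.smult J.I_l_closed)
  with smult show ?case by (simp add: M2.smult_assoc1)
next
  case (sum x y)
  then show ?case
    by (simp add: M2.smult_r_distr ideal_smult_closed ideal_smult.sum)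
qed

lemma submodule_ideal_smult: "submodule (ideal_smult J M2) R2 M2"
proof (rule M2.submoduleI)
  show "ideal_smult J M2 \<subseteq> carrier M2"
    using ideal_smult_closed by blast
  show "\<zero>\<^bsub>M2\<^esub> \<in> ideal_smult J M2"
    using ideal_smult.smult[of "\<zero>\<^bsub>R2\<^esub>" J "\<zero>\<^bsub>M2\<^esub>" M2] by simp
  fix a assume a: "a \<in> ideal_smult J M2"
  have "(\<ominus>\<^bsub>R2\<^esub> \<one>\<^bsub>R2\<^esub>) \<odot>\<^bsub>M2\<^esub> a \<in> ideal_smult J M2"
    using a by (intro smult_ideal_smult) auto
  then show "\<ominus>\<^bsub>M2\<^esub> a \<in> ideal_smult J M2"
    using ideal_smult_closed[OF a] by (simp add: M2.smult_l_minus)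
qed (auto intro: ideal_smult.sum smult_ideal_smult)

lemma amalg_module_smult:
  assumes "r \<in> carrier R1" "j \<in> J" "m1 \<in> carrier M1" "m2 \<in> ideal_smult J M2"
  shows "(r, f r \<oplus>\<^bsub>R2\<^esub> j) \<odot>\<^bsub>amalg_module R2 M1 M2 f \<phi> J\<^esub> (m1, \<phi> m1 \<oplus>\<^bsub>M2\<^esub> m2) =
    (r \<odot>\<^bsub>M1\<^esub> m1,
     \<phi> (r \<odot>\<^bsub>M1\<^esub> m1) \<oplus>\<^bsub>M2\<^esub> f r \<odot>\<^bsub>M2\<^esub> m2 \<oplus>\<^bsub>M2\<^esub> j \<odot>\<^bsub>M2\<^esub> \<phi> m1 \<oplus>\<^bsub>M2\<^esub> j \<odot>\<^bsub>M2\<^esub> m2)"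
proof -
  have [simp]: "j \<in> carrier R2" "m2 \<in> carrier M2"
    using assms J.Icarr ideal_smult_closed by auto
  have "f r \<oplus>\<^bsub>R2\<^esub> j \<ominus>\<^bsub>R2\<^esub> f r = j" "\<phi> m1 \<oplus>\<^bsub>M2\<^esub> m2 \<ominus>\<^bsub>M2\<^esub> \<phi> m1 = m2"
    using assms
    by (simp_all add: a_minus_def R2.a_comm[of "f r" j] R2.a_assoc R2.r_neg
        M2.a_comm[of "\<phi> m1" m2] M2.a_assoc M2.r_neg)
  then show ?thesis by (simp add: amalg_module_def)
qed

lemma amalg_module_smult_pair:
  assumes "r \<in> carrier R1" "s \<in> carrier R2" "m \<in> carrier M1" "n \<in> carrier M2"
  shows "(r, s) \<odot>\<^bsub>amalg_module R2 M1 M2 f \<phi> J\<^esub> (m, n) = (r \<odot>\<^bsub>M1\<^esub> m, s \<odot>\<^bsub>M2\<^esub> n)"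
proof -
  define j x where "j = s \<ominus>\<^bsub>R2\<^esub> f r" and "x = n \<ominus>\<^bsub>M2\<^esub> \<phi> m"
  have [simp]: "j \<in> carrier R2" "x \<in> carrier M2"
    using assms by (auto simp: j_def x_def)
  have s: "s = f r \<oplus>\<^bsub>R2\<^esub> j" and n: "n = \<phi> m \<oplus>\<^bsub>M2\<^esub> x"
    using assms
    by (simp_all add: j_def x_def a_minus_def R2.a_lcomm R2.r_neg M2.a_lcomm M2.r_neg)
  have "s \<odot>\<^bsub>M2\<^esub> n =
      f r \<odot>\<^bsub>M2\<^esub> \<phi> m \<oplus>\<^bsub>M2\<^esub> f r \<odot>\<^bsub>M2\<^esub> x \<oplus>\<^bsub>M2\<^esub> j \<odot>\<^bsub>M2\<^esub> \<phi> m \<oplus>\<^bsub>M2\<^esub> j \<odot>\<^bsub>M2\<^esub> x"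
    using assms unfolding s n
    by (simp add: M2.smult_l_distr M2.smult_r_distr M2.a_ac)
  then show ?thesis
    using assms by (simp add: amalg_module_def Let_def j_def x_def)
qed

lemma amalg_ring_ops:
  "zero (amalg_ring R1 R2 f J) = (\<zero>\<^bsub>R1\<^esub>, \<zero>\<^bsub>R2\<^esub>)"
  "one (amalg_ring R1 R2 f J) = (\<one>\<^bsub>R1\<^esub>, \<one>\<^bsub>R2\<^esub>)"
  "(r, s) \<oplus>\<^bsub>amalg_ring R1 R2 f J\<^esub> (r', s') = (r \<oplus>\<^bsub>R1\<^esub> r', s \<oplus>\<^bsub>R2\<^esub> s')"
  "(r, s) \<otimes>\<^bsub>amalg_ring R1 R2 f J\<^esub> (r', s') = (r \<otimes>\<^bsub>R1\<^esub> r', s \<otimes>\<^bsub>R2\<^esub> s')"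
  by (simp_all add: amalg_ring_def RDirProd_def DirProd_def monoid.defs)

lemma amalg_ring_memI:
  "r \<in> carrier R1 \<Longrightarrow> j \<in> J \<Longrightarrow> s = f r \<oplus>\<^bsub>R2\<^esub> j \<Longrightarrow> (r, s) \<in> carrier (amalg_ring R1 R2 f J)"
  by (auto simp: amalg_ring_def)

lemma amalg_ring_memE:
  assumes "x \<in> carrier (amalg_ring R1 R2 f J)"
  obtains r j where "x = (r, f r \<oplus>\<^bsub>R2\<^esub> j)" "r \<in> carrier R1" "j \<in> J" "j \<in> carrier R2"
  using assms J.Icarr by (auto simp: amalg_ring_def)

lemma amalg_module_memI:
  "m \<in> carrier M1 \<Longrightarrow> x \<in> ideal_smult J M2 \<Longrightarrow> n = \<phi> m \<oplus>\<^bsub>M2\<^esub> x \<Longrightarrow>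
    (m, n) \<in> carrier (amalg_module R2 M1 M2 f \<phi> J)"
  by (auto simp: amalg_module_def)

lemma amalg_module_memE:
  assumes "y \<in> carrier (amalg_module R2 M1 M2 f \<phi> J)"
  obtains m x where "y = (m, \<phi> m \<oplus>\<^bsub>M2\<^esub> x)" "m \<in> carrier M1" "x \<in> ideal_smult J M2"
    "x \<in> carrier M2"
  using assms ideal_smult_closed by (auto simp: amalg_module_def)

lemma cring_amalg_ring: "cring (amalg_ring R1 R2 f J)" (is "cring ?A")
proof -
  have add: "x \<oplus>\<^bsub>?A\<^esub> y \<in> carrier ?A" if x: "x \<in> carrier ?A" and y: "y \<in> carrier ?A" for x y
  proof -
    obtain r j where x: "x = (r, f r \<oplus>\<^bsub>R2\<^esub> j)" "r \<in> carrier R1" "j \<in> J" "j \<in> carrier R2"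
      using x by (rule amalg_ring_memE)
    obtain r' j' where y: "y = (r', f r' \<oplus>\<^bsub>R2\<^esub> j')" "r' \<in> carrier R1" "j' \<in> J" "j' \<in> carrier R2"
      using y by (rule amalg_ring_memE)
    show ?thesis unfolding x(1) y(1) amalg_ring_ops
      by (rule amalg_ring_memI[where j = "j \<oplus>\<^bsub>R2\<^esub> j'"]) (use x y in \<open>simp_all add: R2.a_ac\<close>)
  qed
  have mult: "x \<otimes>\<^bsub>?A\<^esub> y \<in> carrier ?A" if x: "x \<in> carrier ?A" and y: "y \<in> carrier ?A" for x y
  proof -
    obtain r j where x: "x = (r, f r \<oplus>\<^bsub>R2\<^esub> j)" "r \<in> carrier R1" "j \<in> J" "j \<in> carrier R2"
      using x by (rule amalg_ring_memE)
    obtain r' j' where y: "y = (r', f r' \<oplus>\<^bsub>R2\<^esub> j')" "r' \<in> carrier R1" "j' \<in> J" "j' \<in> carrier R2"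
      using y by (rule amalg_ring_memE)
    show ?thesis unfolding x(1) y(1) amalg_ring_ops
      by (rule amalg_ring_memI[where j = "f r \<otimes>\<^bsub>R2\<^esub> j' \<oplus>\<^bsub>R2\<^esub> (j \<otimes>\<^bsub>R2\<^esub> f r' \<oplus>\<^bsub>R2\<^esub> j \<otimes>\<^bsub>R2\<^esub> j')"])
        (use x y in \<open>simp_all add: R2.a_ac R2.l_distr R2.r_distr J.I_l_closed J.I_r_closed\<close>)
  qed
  have inv: "\<exists>y \<in> carrier ?A. y \<oplus>\<^bsub>?A\<^esub> x = \<zero>\<^bsub>?A\<^esub>" if x: "x \<in> carrier ?A" for x
  proof -
    obtain r j where x: "x = (r, f r \<oplus>\<^bsub>R2\<^esub> j)" "r \<in> carrier R1" "j \<in> J" "j \<in> carrier R2"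
      using x by (rule amalg_ring_memE)
    have "f r \<oplus>\<^bsub>R2\<^esub> f (\<ominus>\<^bsub>R1\<^esub> r) = \<zero>\<^bsub>R2\<^esub>"
      using x by (simp add: R1.r_neg flip: f_simps(2))
    then have "f (\<ominus>\<^bsub>R1\<^esub> r) = \<ominus>\<^bsub>R2\<^esub> f r"
      using x by (metis R1.a_inv_closed R2.minus_equality R2.a_comm f_simps(1))
    then have "(\<ominus>\<^bsub>R1\<^esub> r, \<ominus>\<^bsub>R2\<^esub> (f r \<oplus>\<^bsub>R2\<^esub> j)) \<in> carrier ?A"
      using x by (intro amalg_ring_memI[where j = "\<ominus>\<^bsub>R2\<^esub> j"]) (simp_all add: R2.minus_add)
    then show ?thesis
      using x by (intro bexI) (simp_all add: amalg_ring_ops R1.l_neg R2.l_neg)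
  qed
  have zero: "\<zero>\<^bsub>?A\<^esub> \<in> carrier ?A" and one: "\<one>\<^bsub>?A\<^esub> \<in> carrier ?A"
    unfolding amalg_ring_ops by (rule amalg_ring_memI[where j = "\<zero>\<^bsub>R2\<^esub>"]; simp)+
  show ?thesis
  proof (rule cringI)
    show "abelian_group ?A"
      by (rule abelian_groupI; (rule add zero inv)?)
        (auto elim!: amalg_ring_memE simp: amalg_ring_ops R1.a_ac R2.a_ac)
    show "comm_monoid ?A"
      by (rule comm_monoidI; (rule mult one)?)
        (auto elim!: amalg_ring_memE simp: amalg_ring_ops R1.m_ac R2.m_ac)
  qed (auto elim!: amalg_ring_memE simp: amalg_ring_ops R1.l_distr R2.l_distr)
qed

lemma amalg_module_ops:
  "zero (amalg_module R2 M1 M2 f \<phi> J) = (\<zero>\<^bsub>M1\<^esub>, \<zero>\<^bsub>M2\<^esub>)"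
  "(m, n) \<oplus>\<^bsub>amalg_module R2 M1 M2 f \<phi> J\<^esub> (m', n') = (m \<oplus>\<^bsub>M1\<^esub> m', n \<oplus>\<^bsub>M2\<^esub> n')"
  by (simp_all add: amalg_module_def)

lemma module_amalg_module:
  "module (amalg_ring R1 R2 f J) (amalg_module R2 M1 M2 f \<phi> J)" (is "module ?A ?M")
proof -
  interpret JM: submodule "ideal_smult J M2" R2 M2 by (rule submodule_ideal_smult)
  have zeroJM: "\<zero>\<^bsub>M2\<^esub> \<in> ideal_smult J M2"
    using M2.submoduleE(2)[OF submodule_ideal_smult] JM.one_closed by simp
  have add: "x \<oplus>\<^bsub>?M\<^esub> y \<in> carrier ?M" if x: "x \<in> carrier ?M" and y: "y \<in> carrier ?M" for x y
  proof -
    obtain m u where x: "x = (m, \<phi> m \<oplus>\<^bsub>M2\<^esub> u)" "m \<in> carrier M1" "u \<in> ideal_smult J M2" "u \<in> carrier M2"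
      using x by (rule amalg_module_memE)
    obtain m' u' where y: "y = (m', \<phi> m' \<oplus>\<^bsub>M2\<^esub> u')" "m' \<in> carrier M1" "u' \<in> ideal_smult J M2"
      "u' \<in> carrier M2"
      using y by (rule amalg_module_memE)
    show ?thesis unfolding x(1) y(1) amalg_module_ops
      by (rule amalg_module_memI[where x = "u \<oplus>\<^bsub>M2\<^esub> u'"])
        (use x y in \<open>simp_all add: M2.a_ac ideal_smult.sum\<close>)
  qed
  have smult: "a \<odot>\<^bsub>?M\<^esub> x \<in> carrier ?M" if a: "a \<in> carrier ?A" and x: "x \<in> carrier ?M" for a x
  proof -
    obtain r j where a: "a = (r, f r \<oplus>\<^bsub>R2\<^esub> j)" "r \<in> carrier R1" "j \<in> J" "j \<in> carrier R2"
      using a by (rule amalg_ring_memE)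
    obtain m u where x: "x = (m, \<phi> m \<oplus>\<^bsub>M2\<^esub> u)" "m \<in> carrier M1" "u \<in> ideal_smult J M2" "u \<in> carrier M2"
      using x by (rule amalg_module_memE)
    show ?thesis unfolding a(1) x(1) amalg_module_smult[OF a(2,3) x(2,3)]
      by (rule amalg_module_memI[where x =
          "f r \<odot>\<^bsub>M2\<^esub> u \<oplus>\<^bsub>M2\<^esub> (j \<odot>\<^bsub>M2\<^esub> \<phi> m \<oplus>\<^bsub>M2\<^esub> j \<odot>\<^bsub>M2\<^esub> u)"])
        (use a x in \<open>simp_all add: M2.a_assoc smult_ideal_smult ideal_smult.intros\<close>)
  qed
  have inv: "\<exists>y \<in> carrier ?M. y \<oplus>\<^bsub>?M\<^esub> x = \<zero>\<^bsub>?M\<^esub>" if x: "x \<in> carrier ?M" for x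
  proof -
    obtain m u where x: "x = (m, \<phi> m \<oplus>\<^bsub>M2\<^esub> u)" "m \<in> carrier M1" "u \<in> ideal_smult J M2" "u \<in> carrier M2"
      using x by (rule amalg_module_memE)
    have "\<phi> m \<oplus>\<^bsub>M2\<^esub> \<phi> (\<ominus>\<^bsub>M1\<^esub> m) = \<zero>\<^bsub>M2\<^esub>"
      using x by (simp add: M1.r_neg flip: phi_simps(2))
    then have "\<phi> (\<ominus>\<^bsub>M1\<^esub> m) = \<ominus>\<^bsub>M2\<^esub> \<phi> m"
      using x by (metis M1.a_inv_closed M2.minus_equality M2.a_comm phi_simps(1))
    then have "(\<ominus>\<^bsub>M1\<^esub> m, \<ominus>\<^bsub>M2\<^esub> (\<phi> m \<oplus>\<^bsub>M2\<^esub> u)) \<in> carrier ?M"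
      using x M2.submoduleE(3)[OF submodule_ideal_smult]
      by (intro amalg_module_memI[where x = "\<ominus>\<^bsub>M2\<^esub> u"]) (simp_all add: M2.minus_add)
    then show ?thesis
      using x by (intro bexI) (simp_all add: amalg_module_ops M1.l_neg M2.l_neg)
  qed
  have zero: "\<zero>\<^bsub>?M\<^esub> \<in> carrier ?M"
    unfolding amalg_module_ops
    by (rule amalg_module_memI[where x = "\<zero>\<^bsub>M2\<^esub>"]) (simp_all add: zeroJM)
  show ?thesis
  proof (rule moduleI)
    show "abelian_group ?M"
      by (rule abelian_groupI; (rule add zero inv)?)
        (auto elim!: amalg_module_memE simp: amalg_module_ops M1.a_ac M2.a_ac)
    show "cring ?A" by (rule cring_amalg_ring)
    show "a \<odot>\<^bsub>?M\<^esub> x \<in> carrier ?M" if "a \<in> carrier ?A" "x \<in> carrier ?M" for a x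
      using that by (rule smult)
  qed (auto elim!: amalg_ring_memE amalg_module_memE
        simp: amalg_ring_ops amalg_module_ops amalg_module_smult_pair
          M1.smult_l_distr M1.smult_r_distr M1.smult_assoc1
          M2.smult_l_distr M2.smult_r_distr M2.smult_assoc1 M2.a_ac)
qed

end

end

theory Submission
  imports Defs
begin

text \<open>The scalar product of the amalgamated module is the componentwise one,
  \<open>(r, s) (m, n) = (r m, s n)\<close>, and \<open>(m, n)\<close> lies in the submodule lifted from \<open>N\<^sub>2\<close> exactly when
  \<open>n \<in> N\<^sub>2\<close>.  Whether a vector or a product lies in it is therefore decided by second components,
  and surjectivity of \<open>f\<close> and \<open>\<phi>\<close> makes every scalar of \<open>R\<^sub>2\<close> and every vector of \<open>M\<^sub>2\<close> a second component; so the residual of the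
  lifted submodule consists of the pairs whose second component is in the residual of \<open>N\<^sub>2\<close>.  Only
  the condition that the product be nonzero sees the first component: \<open>(r m, s n)\<close> can be nonzero
  although \<open>s n = 0\<close>.  The lifted submodule is thus weakly prime exactly when \<open>N\<^sub>2\<close> is and no such
  pair is a counterexample, that is, when \<open>s n = 0\<close>, \<open>s \<notin> (N\<^sub>2 : M\<^sub>2)\<close> and \<open>n \<notin> N\<^sub>2\<close> force \<open>r m = 0\<close>.  This is
  the first part.

  For the second part it is enough to know that \<open>N = N\<^sub>2\<close> is weakly prime in \<open>M = M\<^sub>2\<close>.  Let
  \<open>0 \<noteq> r m\<close> with \<open>J r m \<subseteq> N\<close>, and suppose that \<open>j m \<notin> N\<close> for some \<open>j \<in> J\<close>.  If \<open>r (j m) \<noteq> 0\<close>, weak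
  primeness gives \<open>r \<in> (N : M)\<close>.  Otherwise \<open>j (r m) = 0\<close>, and \<open>j\<close> kills a nonzero element of
  \<open>N\<close>: the element \<open>r m\<close> itself if it lies in \<open>N\<close>, and otherwise all of \<open>N\<close>
  (\<open>twin_zero_annihilates\<close>), which is nonzero because \<open>0 \<in> Z(N)\<close>.  As only \<open>0 \<in> J\<close> can do that,
  \<open>j = 0\<close>, contradicting \<open>j m \<notin> N\<close>.\<close>

section \<open>Residuals of weakly prime submodules\<close>

lemma weakly_prime_submoduleD:
  assumes "weakly_prime_submodule N R M" "r \<in> carrier R" "m \<in> carrier M"
    and "r \<odot>\<^bsub>M\<^esub> m \<noteq> \<zero>\<^bsub>M\<^esub>" "r \<odot>\<^bsub>M\<^esub> m \<in> N"
  shows "r \<in> residual_ideal R M N \<or> m \<in> N"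
  using assms unfolding weakly_prime_submodule_def by blast

context module
begin

text \<open>If \<open>r n \<noteq> 0\<close> for some \<open>n \<in> N\<close>, then \<open>r (m + n) = r n\<close> is a nonzero element of \<open>N\<close>, although
  neither \<open>r \<in> (N : M)\<close> nor \<open>m + n \<in> N\<close>.\<close>

lemma twin_zero_annihilates:
  assumes wp: "weakly_prime_submodule N R M"
    and r: "r \<in> carrier R" "r \<notin> residual_ideal R M N"
    and m: "m \<in> carrier M" "m \<notin> N"
    and rm: "r \<odot>\<^bsub>M\<^esub> m = \<zero>\<^bsub>M\<^esub>"
    and n: "n \<in> N"
  shows "r \<odot>\<^bsub>M\<^esub> n = \<zero>\<^bsub>M\<^esub>"
proof (rule ccontr)
  assume nz: "r \<odot>\<^bsub>M\<^esub> n \<noteq> \<zero>\<^bsub>M\<^esub>"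
  have N: "submodule N R M"
    using wp by (simp add: weakly_prime_submodule_def)
  have nM: "n \<in> carrier M"
    using submoduleE(1)[OF N] n by blast
  have eq: "r \<odot>\<^bsub>M\<^esub> (m \<oplus>\<^bsub>M\<^esub> n) = r \<odot>\<^bsub>M\<^esub> n"
    using r m nM rm by (simp add: smult_r_distr)
  have "m \<oplus>\<^bsub>M\<^esub> n \<in> N"
    using weakly_prime_submoduleD[OF wp r(1), of "m \<oplus>\<^bsub>M\<^esub> n"] r m nM n nz submoduleE(4)[OF N]
    unfolding eq by auto
  then have "(m \<oplus>\<^bsub>M\<^esub> n) \<oplus>\<^bsub>M\<^esub> \<ominus>\<^bsub>M\<^esub> n \<in> N"
    using n submoduleE(3,5)[OF N] by blast
  then show False
    using m nM by (simp add: M.a_assoc M.r_neg)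
qed

lemma zero_in_submodule:
  assumes N: "submodule N R M"
  shows "\<zero>\<^bsub>M\<^esub> \<in> N"
proof -
  obtain n where n: "n \<in> N"
    using submoduleE(2)[OF N] by blast
  then have "\<zero> \<odot>\<^bsub>M\<^esub> n \<in> N" "n \<in> carrier M"
    using submoduleE(1,4)[OF N] by auto
  then show ?thesis
    by simp
qed

lemma submodule_residual_submodule:
  assumes N: "submodule N R M" and J: "J \<subseteq> carrier R"
  shows "submodule (residual_submodule M N J) R M"
proof (rule submoduleI)
  show "residual_submodule M N J \<subseteq> carrier M"
    by (auto simp: residual_submodule_def)
  show "\<zero>\<^bsub>M\<^esub> \<in> residual_submodule M N J"
    using J zero_in_submodule[OF N] by (auto simp: residual_submodule_def)
next
  fix a assume "a \<in> residual_submodule M N J"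
  then show "\<ominus>\<^bsub>M\<^esub> a \<in> residual_submodule M N J"
    using J submoduleE(3)[OF N] by (auto simp: residual_submodule_def smult_r_minus subset_iff)
next
  fix a b assume "a \<in> residual_submodule M N J" "b \<in> residual_submodule M N J"
  then show "a \<oplus>\<^bsub>M\<^esub> b \<in> residual_submodule M N J"
    using J submoduleE(5)[OF N] by (auto simp: residual_submodule_def smult_r_distr subset_iff)
next
  fix a x assume a: "a \<in> carrier R" and x: "x \<in> residual_submodule M N J"
  have "j \<odot>\<^bsub>M\<^esub> (a \<odot>\<^bsub>M\<^esub> x) = a \<odot>\<^bsub>M\<^esub> (j \<odot>\<^bsub>M\<^esub> x)" if "j \<in> J" for j
    using that a x J by (auto simp: residual_submodule_def R.m_comm simp flip: smult_assoc1)
  then show "a \<odot>\<^bsub>M\<^esub> x \<in> residual_submodule M N J"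
    using a x submoduleE(4)[OF N] by (auto simp: residual_submodule_def)
qed

text \<open>The zero module has no zero divisors, so the hypothesis \<open>Z(N) \<inter> J = {0}\<close> also says that
  \<open>N\<close> is nonzero.\<close>

lemma weakly_prime_residual_submodule:
  assumes wp: "weakly_prime_submodule N R M"
    and J: "J \<subseteq> carrier R" "\<not> J \<subseteq> residual_ideal R M N"
    and Z: "zero_divisors R (M\<lparr>carrier := N\<rparr>) \<inter> J = {\<zero>}"
  shows "weakly_prime_submodule (residual_submodule M N J) R M"
  unfolding weakly_prime_submodule_def
proof (intro conjI ballI impI)
  have N: "submodule N R M"
    using wp by (simp add: weakly_prime_submodule_def)
  show "submodule (residual_submodule M N J) R M"
    using N J(1) by (rule submodule_residual_submodule)
  show "residual_submodule M N J \<noteq> carrier M"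
    using J by (auto simp: residual_submodule_def residual_ideal_def)
  fix r m
  assume r: "r \<in> carrier R" and m: "m \<in> carrier M"
    and rm: "r \<odot>\<^bsub>M\<^esub> m \<noteq> \<zero>\<^bsub>M\<^esub> \<and> r \<odot>\<^bsub>M\<^esub> m \<in> residual_submodule M N J"
  have J_nzd: "j = \<zero>" if "j \<in> J" "x \<in> N" "x \<noteq> \<zero>\<^bsub>M\<^esub>" "j \<odot>\<^bsub>M\<^esub> x = \<zero>\<^bsub>M\<^esub>" for j x
    using that Z J(1) by (auto simp: zero_divisors_def)
  show "r \<in> residual_ideal R M (residual_submodule M N J) \<or> m \<in> residual_submodule M N J"
  proof (rule disjCI)
    assume "m \<notin> residual_submodule M N J"
    then obtain j where j: "j \<in> J" "j \<odot>\<^bsub>M\<^esub> m \<notin> N"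
      using m by (auto simp: residual_submodule_def)
    have jR: "j \<in> carrier R"
      using j J by blast
    have comm: "j \<odot>\<^bsub>M\<^esub> (r \<odot>\<^bsub>M\<^esub> m) = r \<odot>\<^bsub>M\<^esub> (j \<odot>\<^bsub>M\<^esub> m)"
      using r m jR by (simp add: R.m_comm flip: smult_assoc1)
    have jrm_in: "j \<odot>\<^bsub>M\<^esub> (r \<odot>\<^bsub>M\<^esub> m) \<in> N"
      using rm j by (simp add: residual_submodule_def)
    have j_nz: "j \<noteq> \<zero>"
      using j m zero_in_submodule[OF N] by auto
    have j_res: "j \<notin> residual_ideal R M N"
      using j m by (auto simp: residual_ideal_def)
    have "j \<odot>\<^bsub>M\<^esub> (r \<odot>\<^bsub>M\<^esub> m) \<noteq> \<zero>\<^bsub>M\<^esub>"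
    proof
      assume jrm: "j \<odot>\<^bsub>M\<^esub> (r \<odot>\<^bsub>M\<^esub> m) = \<zero>\<^bsub>M\<^esub>"
      show False
      proof (cases "r \<odot>\<^bsub>M\<^esub> m \<in> N")
        case True
        then show False
          using J_nzd[OF j(1) True] rm jrm j_nz by blast
      next
        case False
        have "\<zero> \<in> zero_divisors R (M\<lparr>carrier := N\<rparr>)"
          using Z by blast
        then obtain x where x: "x \<in> N" "x \<noteq> \<zero>\<^bsub>M\<^esub>"
          by (auto simp: zero_divisors_def)
        have "j \<odot>\<^bsub>M\<^esub> x = \<zero>\<^bsub>M\<^esub>"
          using r m x(1) by (intro twin_zero_annihilates[OF wp jR j_res _ False jrm]) auto
        then show False
          using J_nzd[OF j(1) x] j_nz by blast
      qed
    qed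
    then have "r \<in> residual_ideal R M N"
      using weakly_prime_submoduleD[OF wp r, of "j \<odot>\<^bsub>M\<^esub> m"] comm jrm_in jR m j(2) by auto
    then have "r \<odot>\<^bsub>M\<^esub> n \<in> N" if "n \<in> carrier M" for n
      using that by (simp add: residual_ideal_def)
    moreover have "i \<odot>\<^bsub>M\<^esub> (r \<odot>\<^bsub>M\<^esub> n) = r \<odot>\<^bsub>M\<^esub> (i \<odot>\<^bsub>M\<^esub> n)" if "i \<in> J" "n \<in> carrier M" for i n
      using that r J(1) by (auto simp: R.m_comm simp flip: smult_assoc1)
    ultimately show "r \<in> residual_ideal R M (residual_submodule M N J)"
      using r J(1) by (auto simp: residual_ideal_def residual_submodule_def)
  qed
qed

end

section \<open>Weakly prime submodules of the amalgamated module\<close>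

context amalgamation
begin

lemma amalg_submodule_eq:
  "amalg_submodule M1 M2 \<phi> J N =
    {x \<in> carrier (amalg_module R2 M1 M2 f \<phi> J). snd x \<in> N}"
  by (auto simp: amalg_submodule_def amalg_module_def)

lemma zero_in_ideal_smult: "\<zero>\<^bsub>M2\<^esub> \<in> ideal_smult J M2"
  using ideal_smult.smult[of "\<zero>\<^bsub>R2\<^esub>" J "\<zero>\<^bsub>M2\<^esub>" M2] by simp

lemma diagonal_in_amalg_ring:
  assumes "r \<in> carrier R1"
  shows "(r, f r) \<in> carrier (amalg_ring R1 R2 f J)"
  using assms by (intro amalg_ring_memI[where j = "\<zero>\<^bsub>R2\<^esub>"]) auto

lemma diagonal_in_amalg_module:
  assumes "m \<in> carrier M1"
  shows "(m, \<phi> m) \<in> carrier (amalg_module R2 M1 M2 f \<phi> J)"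
  using assms zero_in_ideal_smult by (intro amalg_module_memI[where x = "\<zero>\<^bsub>M2\<^esub>"]) auto

lemma amalg_module_smult_mem:
  assumes a: "(r, s) \<in> carrier (amalg_ring R1 R2 f J)"
    and x: "(m, n) \<in> carrier (amalg_module R2 M1 M2 f \<phi> J)"
  shows "(r, s) \<odot>\<^bsub>amalg_module R2 M1 M2 f \<phi> J\<^esub> (m, n) = (r \<odot>\<^bsub>M1\<^esub> m, s \<odot>\<^bsub>M2\<^esub> n)"
  using a x by (elim amalg_ring_memE amalg_module_memE) (auto intro!: amalg_module_smult_pair)

lemma submodule_amalg_submodule:
  assumes N: "submodule N R2 M2"
  shows "submodule (amalg_submodule M1 M2 \<phi> J N)
    (amalg_ring R1 R2 f J) (amalg_module R2 M1 M2 f \<phi> J)" (is "submodule ?N ?A ?M")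
proof -
  interpret A: module ?A ?M
    by (rule module_amalg_module)
  have smult: "a \<odot>\<^bsub>?M\<^esub> x \<in> ?N" if a: "a \<in> carrier ?A" and x: "x \<in> ?N" for a x
  proof -
    obtain r s m n where eq: "a = (r, s)" "x = (m, n)"
      by (cases a, cases x)
    have s: "s \<in> carrier R2"
      using a unfolding eq by (auto elim!: amalg_ring_memE)
    show ?thesis
      using a x A.smult_closed[OF a, of x] amalg_module_smult_mem[of r s m n] s M2.submoduleE(4)[OF N]
      by (simp add: eq amalg_submodule_eq)
  qed
  have minus: "\<ominus>\<^bsub>?M\<^esub> x = (\<ominus>\<^bsub>?A\<^esub> \<one>\<^bsub>?A\<^esub>) \<odot>\<^bsub>?M\<^esub> x" if "x \<in> carrier ?M" for x
    using that by (simp add: A.smult_l_minus)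
  show ?thesis
  proof (rule A.submoduleI)
    show "?N \<subseteq> carrier ?M"
      by (auto simp: amalg_submodule_eq)
    show "\<zero>\<^bsub>?M\<^esub> \<in> ?N"
      using M2.zero_in_submodule[OF N] A.M.zero_closed by (simp add: amalg_submodule_eq amalg_module_ops)
    show "\<ominus>\<^bsub>?M\<^esub> x \<in> ?N" if "x \<in> ?N" for x
      using that smult[of "\<ominus>\<^bsub>?A\<^esub> \<one>\<^bsub>?A\<^esub>" x] minus[of x] by (auto simp: amalg_submodule_eq)
    show "x \<oplus>\<^bsub>?M\<^esub> y \<in> ?N" if "x \<in> ?N" "y \<in> ?N" for x y
      using that A.M.a_closed[of x y] M2.submoduleE(5)[OF N]
      by (cases x; cases y) (auto simp: amalg_submodule_eq amalg_module_ops)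
  qed (fact smult)
qed

text \<open>Given \<open>n \<in> M\<^sub>2\<close>, surjectivity of \<open>\<phi>\<close> gives some \<open>(m, n)\<close> in the amalgamated module, on which
  the pair \<open>(r, s)\<close> can be tested.\<close>

lemma residual_ideal_amalg_submodule:
  assumes phi_surj: "\<phi> ` carrier M1 = carrier M2"
    and a: "(r, s) \<in> carrier (amalg_ring R1 R2 f J)"
  shows "(r, s) \<in> residual_ideal (amalg_ring R1 R2 f J) (amalg_module R2 M1 M2 f \<phi> J)
      (amalg_submodule M1 M2 \<phi> J N) \<longleftrightarrow> s \<in> residual_ideal R2 M2 N"
    (is "_ \<in> residual_ideal ?A ?M ?N \<longleftrightarrow> _")
proof -
  interpret A: module ?A ?M
    by (rule module_amalg_module)
  have s: "s \<in> carrier R2"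
    using a by (auto elim!: amalg_ring_memE)
  have test: "(r, s) \<odot>\<^bsub>?M\<^esub> (m, n) \<in> ?N \<longleftrightarrow> s \<odot>\<^bsub>M2\<^esub> n \<in> N" if "(m, n) \<in> carrier ?M" for m n
    using A.smult_closed[OF a that] amalg_module_smult_mem[OF a that]
    by (simp add: amalg_submodule_eq)
  have "(\<forall>x \<in> carrier ?M. (r, s) \<odot>\<^bsub>?M\<^esub> x \<in> ?N) \<longleftrightarrow> (\<forall>n \<in> carrier M2. s \<odot>\<^bsub>M2\<^esub> n \<in> N)"
  proof (intro iffI ballI)
    fix n assume all: "\<forall>x \<in> carrier ?M. (r, s) \<odot>\<^bsub>?M\<^esub> x \<in> ?N" and "n \<in> carrier M2"
    then obtain m where "m \<in> carrier M1" "n = \<phi> m"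
      using phi_surj by blast
    then show "s \<odot>\<^bsub>M2\<^esub> n \<in> N"
      using all test diagonal_in_amalg_module by blast
  next
    fix x assume all: "\<forall>n \<in> carrier M2. s \<odot>\<^bsub>M2\<^esub> n \<in> N" and x: "x \<in> carrier ?M"
    then show "(r, s) \<odot>\<^bsub>?M\<^esub> x \<in> ?N"
      using test by (cases x) (auto elim!: amalg_module_memE)
  qed
  then show ?thesis
    using a s by (simp add: residual_ideal_def)
qed

text \<open>A product \<open>(r m, s n)\<close> in the lifted submodule with \<open>s n \<noteq> 0\<close> is governed by weak primeness of
  \<open>N\<close>; the second condition is exactly weak primeness of the lifted submodule for the products
  \<open>(r m, 0)\<close>.\<close>

lemma weakly_prime_amalg_submodule_iff:
  assumes f_surj: "f ` carrier R1 = carrier R2"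
    and phi_surj: "\<phi> ` carrier M1 = carrier M2"
    and N: "submodule N R2 M2"
  shows "weakly_prime_submodule (amalg_submodule M1 M2 \<phi> J N)
      (amalg_ring R1 R2 f J) (amalg_module R2 M1 M2 f \<phi> J) \<longleftrightarrow>
    weakly_prime_submodule N R2 M2 \<and>
    (\<forall>r \<in> carrier R1. \<forall>m \<in> carrier M1. \<forall>m' \<in> ideal_smult J M2. \<forall>j \<in> J.
      (f r \<oplus>\<^bsub>R2\<^esub> j) \<odot>\<^bsub>M2\<^esub> (\<phi> m \<oplus>\<^bsub>M2\<^esub> m') = \<zero>\<^bsub>M2\<^esub> \<and>
      f r \<oplus>\<^bsub>R2\<^esub> j \<notin> residual_ideal R2 M2 N \<and> \<phi> m \<oplus>\<^bsub>M2\<^esub> m' \<notin> N \<longrightarrow>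
      r \<odot>\<^bsub>M1\<^esub> m = \<zero>\<^bsub>M1\<^esub>)"
    (is "weakly_prime_submodule ?N ?A ?M \<longleftrightarrow> _ \<and> ?twin_zeros")
proof -
  interpret A: module ?A ?M
    by (rule module_amalg_module)
  have proper: "?N \<noteq> carrier ?M \<longleftrightarrow> N \<noteq> carrier M2"
  proof -
    have "?N \<noteq> carrier ?M \<longleftrightarrow> (\<exists>x \<in> carrier ?M. snd x \<notin> N)"
      by (auto simp: amalg_submodule_eq)
    also have "\<dots> \<longleftrightarrow> (\<exists>n \<in> carrier M2. n \<notin> N)"
    proof
      assume "\<exists>x \<in> carrier ?M. snd x \<notin> N"
      then show "\<exists>n \<in> carrier M2. n \<notin> N"
        by (auto elim!: amalg_module_memE)
    next
      assume "\<exists>n \<in> carrier M2. n \<notin> N"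
      then obtain m where "m \<in> carrier M1" "\<phi> m \<notin> N"
        unfolding phi_surj[symmetric] by blast
      then show "\<exists>x \<in> carrier ?M. snd x \<notin> N"
        using diagonal_in_amalg_module by (intro bexI[of _ "(m, \<phi> m)"]) auto
    qed
    also have "\<dots> \<longleftrightarrow> N \<noteq> carrier M2"
      using M2.submoduleE(1)[OF N] by blast
    finally show ?thesis .
  qed
  have lifted: "(r, s) \<in> residual_ideal ?A ?M ?N \<or> (m, n) \<in> ?N \<longleftrightarrow>
      s \<in> residual_ideal R2 M2 N \<or> n \<in> N"
    if "(r, s) \<in> carrier ?A" "(m, n) \<in> carrier ?M" for r s m n
    using that residual_ideal_amalg_submodule[OF phi_surj] by (simp add: amalg_submodule_eq)
  show ?thesis
  proof (intro iffI conjI)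
    assume wp: "weakly_prime_submodule ?N ?A ?M"
    have step: "s \<in> residual_ideal R2 M2 N \<or> n \<in> N"
      if "(r, s) \<in> carrier ?A" "(m, n) \<in> carrier ?M"
        "r \<odot>\<^bsub>M1\<^esub> m \<noteq> \<zero>\<^bsub>M1\<^esub> \<or> s \<odot>\<^bsub>M2\<^esub> n \<noteq> \<zero>\<^bsub>M2\<^esub>" "s \<odot>\<^bsub>M2\<^esub> n \<in> N" for r s m n
      using weakly_prime_submoduleD[OF wp that(1,2)] that A.smult_closed[OF that(1,2)]
        amalg_module_smult_mem[OF that(1,2)] lifted[OF that(1,2)]
      by (simp add: amalg_submodule_eq amalg_module_ops)
    show "weakly_prime_submodule N R2 M2"
      unfolding weakly_prime_submodule_def
    proof (intro conjI ballI impI)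
      show "submodule N R2 M2" by (fact N)
      show "N \<noteq> carrier M2"
        using wp proper by (simp add: weakly_prime_submodule_def)
      fix s n
      assume "s \<in> carrier R2" "n \<in> carrier M2"
        and sn: "s \<odot>\<^bsub>M2\<^esub> n \<noteq> \<zero>\<^bsub>M2\<^esub> \<and> s \<odot>\<^bsub>M2\<^esub> n \<in> N"
      then obtain r m where "r \<in> carrier R1" "s = f r" "m \<in> carrier M1" "n = \<phi> m"
        using f_surj phi_surj by blast
      then show "s \<in> residual_ideal R2 M2 N \<or> n \<in> N"
        using step[of r s m n] sn diagonal_in_amalg_ring diagonal_in_amalg_module by simp
    qed
    show ?twin_zeros
    proof (intro ballI impI, rule ccontr)
      fix r m m' j
      assume "r \<in> carrier R1" "m \<in> carrier M1" "m' \<in> ideal_smult J M2" "j \<in> J"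
      then have mem: "(r, f r \<oplus>\<^bsub>R2\<^esub> j) \<in> carrier ?A" "(m, \<phi> m \<oplus>\<^bsub>M2\<^esub> m') \<in> carrier ?M"
        by (auto intro: amalg_ring_memI amalg_module_memI)
      assume "(f r \<oplus>\<^bsub>R2\<^esub> j) \<odot>\<^bsub>M2\<^esub> (\<phi> m \<oplus>\<^bsub>M2\<^esub> m') = \<zero>\<^bsub>M2\<^esub> \<and>
        f r \<oplus>\<^bsub>R2\<^esub> j \<notin> residual_ideal R2 M2 N \<and> \<phi> m \<oplus>\<^bsub>M2\<^esub> m' \<notin> N"
        and "r \<odot>\<^bsub>M1\<^esub> m \<noteq> \<zero>\<^bsub>M1\<^esub>"
      then show False
        using step[OF mem] M2.zero_in_submodule[OF N] by simp
    qed
  next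
    assume "weakly_prime_submodule N R2 M2 \<and> ?twin_zeros"
    then have wp: "weakly_prime_submodule N R2 M2" and twin_zeros: ?twin_zeros
      by blast+
    show "weakly_prime_submodule ?N ?A ?M"
      unfolding weakly_prime_submodule_def
    proof (intro conjI ballI impI)
      show "submodule ?N ?A ?M"
        using N by (rule submodule_amalg_submodule)
      show "?N \<noteq> carrier ?M"
        using wp proper by (simp add: weakly_prime_submodule_def)
      fix a x
      assume a: "a \<in> carrier ?A" and x: "x \<in> carrier ?M"
        and ax: "a \<odot>\<^bsub>?M\<^esub> x \<noteq> \<zero>\<^bsub>?M\<^esub> \<and> a \<odot>\<^bsub>?M\<^esub> x \<in> ?N"
      obtain r j where a_eq: "a = (r, f r \<oplus>\<^bsub>R2\<^esub> j)" "r \<in> carrier R1" "j \<in> J" "j \<in> carrier R2"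
        using a by (rule amalg_ring_memE)
      obtain m m' where x_eq: "x = (m, \<phi> m \<oplus>\<^bsub>M2\<^esub> m')" "m \<in> carrier M1" "m' \<in> ideal_smult J M2"
        "m' \<in> carrier M2"
        using x by (rule amalg_module_memE)
      let ?s = "f r \<oplus>\<^bsub>R2\<^esub> j" and ?n = "\<phi> m \<oplus>\<^bsub>M2\<^esub> m'"
      have smult: "a \<odot>\<^bsub>?M\<^esub> x = (r \<odot>\<^bsub>M1\<^esub> m, ?s \<odot>\<^bsub>M2\<^esub> ?n)"
        using a_eq x_eq by (simp add: amalg_module_smult_pair)
      have sn: "?s \<odot>\<^bsub>M2\<^esub> ?n \<in> N"
        using ax smult by (simp add: amalg_submodule_eq)
      have "?s \<in> residual_ideal R2 M2 N \<or> ?n \<in> N"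
      proof (cases "?s \<odot>\<^bsub>M2\<^esub> ?n = \<zero>\<^bsub>M2\<^esub>")
        case True
        then have "r \<odot>\<^bsub>M1\<^esub> m \<noteq> \<zero>\<^bsub>M1\<^esub>"
          using ax smult by (simp add: amalg_module_ops)
        then show ?thesis
          using twin_zeros a_eq x_eq True by blast
      next
        case False
        then show ?thesis
          using weakly_prime_submoduleD[OF wp _ _ False sn] a_eq x_eq by simp
      qed
      then show "a \<in> residual_ideal ?A ?M ?N \<or> x \<in> ?N"
        using lifted a x a_eq(1) x_eq(1) by simp
    qed
  qed
qed

end

theorem corollary6:
  fixes R1 :: "('a, 'k) ring_scheme" and R2 :: "('b, 'l) ring_scheme"
    and M1 :: "('a, 'm, 'p) module_scheme" and M2 :: "('b, 'n, 'q) module_scheme"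
    and f :: "'a \<Rightarrow> 'b" and \<phi> :: "'m \<Rightarrow> 'n" and J :: "'b set" and N2 :: "'n set"
  assumes "cring R1" "\<one>\<^bsub>R1\<^esub> \<noteq> \<zero>\<^bsub>R1\<^esub>"
    and "cring R2" "\<one>\<^bsub>R2\<^esub> \<noteq> \<zero>\<^bsub>R2\<^esub>"
    and "f \<in> ring_hom R1 R2" "f ` carrier R1 = carrier R2"
    and "ideal J R2"
    and "module R1 M1" "module R2 M2"
    and "\<phi> \<in> module_homs R1 M1 (restrict_scalars f M2)" "\<phi> ` carrier M1 = carrier M2"
    and "submodule N2 R2 M2"
  shows "(weakly_prime_submodule (amalg_submodule M1 M2 \<phi> J N2)
            (amalg_ring R1 R2 f J) (amalg_module R2 M1 M2 f \<phi> J) \<longleftrightarrow>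
          weakly_prime_submodule N2 R2 M2 \<and>
          (\<forall>r1 \<in> carrier R1. \<forall>m1 \<in> carrier M1. \<forall>m2 \<in> ideal_smult J M2. \<forall>j \<in> J.
            (f r1 \<oplus>\<^bsub>R2\<^esub> j) \<odot>\<^bsub>M2\<^esub> (\<phi> m1 \<oplus>\<^bsub>M2\<^esub> m2) = \<zero>\<^bsub>M2\<^esub> \<and>
            f r1 \<oplus>\<^bsub>R2\<^esub> j \<notin> residual_ideal R2 M2 N2 \<and>
            \<phi> m1 \<oplus>\<^bsub>M2\<^esub> m2 \<notin> N2 \<longrightarrow>
            r1 \<odot>\<^bsub>M1\<^esub> m1 = \<zero>\<^bsub>M1\<^esub>))
       \<and> (weakly_prime_submodule (amalg_submodule M1 M2 \<phi> J N2)
            (amalg_ring R1 R2 f J) (amalg_module R2 M1 M2 f \<phi> J) \<and>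
          \<not> J \<subseteq> residual_ideal R2 M2 N2 \<and>
          zero_divisors R2 (M2\<lparr>carrier := N2\<rparr>) \<inter> J = {\<zero>\<^bsub>R2\<^esub>} \<longrightarrow>
          weakly_prime_submodule (residual_submodule M2 N2 J) R2 M2)"
proof -
  interpret amalgamation R1 R2 J M1 M2 f \<phi>
    using assms by (intro amalgamation.intro amalgamation_axioms.intro)
  note iff = weakly_prime_amalg_submodule_iff[OF assms(6,11,12)]
  have "J \<subseteq> carrier R2"
    using J.Icarr by blast
  then show ?thesis
    using iff M2.weakly_prime_residual_submodule by blast
qed

end
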